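(* The set $\mathrm{BCL}=\{e\in\mathbb N : \mathcal L_e \text{ is TxtBC-learnable}\}$, where $\mathcal L_e$ is the uniformly computably enumerable family coded by $e$, is a $\Sigma^0_5$ set (that is, it has a $\Sigma_5^0$ description).
   Context: Fix a computable pairing function $\langle\cdot,\cdot\rangle:\mathbb N^2\to\mathbb N$ and a standard numbering $W_0,W_1,\dots$ of the computably enumerable (c.e.) sets. A number $e$ codes the uniformly computably enumerable (u.c.e.) family $\mathcal L_e=\{L_0,L_1,\dots\}$ whose $i$-th member (column) is $L_i=\{x:\langle i,x\rangle\in W_e\}$; the u.c.e. families are exactly those of this form. An enumeration is a function $f:\mathbb N\to\mathbb N$; $\mathrm{content}(f)=\{x:(\exists n)\,f(n)=x\}$; $f$ is an enumeration of (for) a set $A$ if $\mathrm{content}(f)=A$. $f\upharpoonright i$ is the initial segment of $f$ of length $i$, a finite string of natural numbers. A learning machine is a (possibly partial) computable function $M$ from finite strings of natural numbers to $\mathbb N$; a statement about a value of $M$ includes that this value is defined. $M$ TxtBC-identifies an enumeration $f$ if there is $n$ such that $W_{M(f\upharpoonright i)}=\mathrm{content}(f)$ for all $i>n$. $M$ TxtBC-learns a c.e. set $A$ if it TxtBC-identifies every enumeration of $A$. $M$ TxtBC-learns a family of c.e. sets if it TxtBC-learns every member of the family. A family is TxtBC-learnable if some learning machine TxtBC-learns it. *)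

theory Defs
  imports Main "HOL-Library.Nat_Bijection"
begin

section \<open>Computability\<close>

text \<open>
  The partial computable functions, as unary functions on the naturals; several arguments are
  packed into one by the Cantor pairing \<open>prod_encode\<close>.  Since \<open>prod_encode\<close> and both components of
  its inverse are primitive recursive, this is Kleene's class: rule \<open>prec\<close> is primitive recursion
  with parameter, and rule \<open>minim\<close> is unbounded minimisation, which requires all values before the
  first zero to be defined.
\<close>

inductive partial_computable :: "(nat \<Rightarrow> nat option) \<Rightarrow> bool" where
  zero: "partial_computable (\<lambda>_. Some 0)"
| suc: "partial_computable (\<lambda>x. Some (Suc x))"
| left: "partial_computable (\<lambda>x. Some (fst (prod_decode x)))"
| right: "partial_computable (\<lambda>x. Some (snd (prod_decode x)))"
| pair: "partial_computable f \<Longrightarrow> partial_computable g \<Longrightarrow>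
    partial_computable (\<lambda>x. Option.bind (f x) (\<lambda>a. Option.bind (g x) (\<lambda>b. Some (prod_encode (a, b)))))"
| comp: "partial_computable f \<Longrightarrow> partial_computable g \<Longrightarrow>
    partial_computable (\<lambda>x. Option.bind (g x) f)"
| prec: "partial_computable f \<Longrightarrow> partial_computable g \<Longrightarrow>
    partial_computable (\<lambda>x. case prod_decode x of (a, n) \<Rightarrow>
      rec_nat (f a) (\<lambda>k r. Option.bind r (\<lambda>v. g (prod_encode (a, prod_encode (k, v))))) n)"
| minim: "partial_computable f \<Longrightarrow>
    partial_computable (\<lambda>x.
      if \<exists>n. f (prod_encode (x, n)) = Some 0 \<and> (\<forall>k<n. f (prod_encode (x, k)) \<noteq> None)
      then Some (LEAST n. f (prod_encode (x, n)) = Some 0) else None)"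

definition computable :: "(nat \<Rightarrow> nat) \<Rightarrow> bool" where
  "computable f \<longleftrightarrow> partial_computable (\<lambda>x. Some (f x))"

definition computable2 :: "(nat \<Rightarrow> nat \<Rightarrow> nat) \<Rightarrow> bool" where
  "computable2 f \<longleftrightarrow> computable (\<lambda>z. f (fst (prod_decode z)) (snd (prod_decode z)))"

definition decidable :: "nat set \<Rightarrow> bool" where
  "decidable A \<longleftrightarrow> computable (\<lambda>x. if x \<in> A then 1 else 0)"

definition ce :: "nat set \<Rightarrow> bool" where
  "ce A \<longleftrightarrow> (\<exists>f. partial_computable f \<and> A = dom f)"

text \<open>\<open>Sigma0 n A\<close>: the set \<open>A\<close> is \<open>\<Sigma>\<^sup>0\<^sub>n\<close>.\<close>

fun Sigma0 :: "nat \<Rightarrow> nat set \<Rightarrow> bool" and Pi0 :: "nat \<Rightarrow> nat set \<Rightarrow> bool" where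
  "Sigma0 0 A \<longleftrightarrow> decidable A"
| "Sigma0 (Suc n) A \<longleftrightarrow> (\<exists>B. Pi0 n B \<and> A = {x. \<exists>y. prod_encode (x, y) \<in> B})"
| "Pi0 0 A \<longleftrightarrow> decidable A"
| "Pi0 (Suc n) A \<longleftrightarrow> (\<exists>B. Sigma0 n B \<and> A = {x. \<forall>y. prod_encode (x, y) \<in> B})"

text \<open>Surjectivity is not demanded of a pairing function, so that both common conventions are
  covered.\<close>

definition computable_pairing :: "(nat \<Rightarrow> nat \<Rightarrow> nat) \<Rightarrow> bool" where
  "computable_pairing pr \<longleftrightarrow> computable2 pr \<and> (\<forall>i x j y. pr i x = pr j y \<longrightarrow> i = j \<and> x = y)"

text \<open>
  The standard numberings of the c.e. sets are the acceptable ones in the sense of Rogers: those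
  for which the enumeration theorem (first conjunct) and the s-m-n theorem (second conjunct) hold;
  equivalently, those intertranslatable by computable functions with the domains of the
  \<open>e\<close>-th partial computable functions.  Since a c.e. \<open>A\<close> is the \<open>0\<close>-th section of a c.e. set,
  every c.e. set is some \<open>W e\<close>.
\<close>

definition standard_numbering :: "(nat \<Rightarrow> nat set) \<Rightarrow> bool" where
  "standard_numbering W \<longleftrightarrow>
     ce {prod_encode (e, x) | e x. x \<in> W e} \<and>
     (\<forall>A. ce A \<longrightarrow> (\<exists>g. computable g \<and> (\<forall>e. W (g e) = {x. prod_encode (e, x) \<in> A})))"

section \<open>Learning\<close>

definition column :: "(nat \<Rightarrow> nat \<Rightarrow> nat) \<Rightarrow> (nat \<Rightarrow> nat set) \<Rightarrow> nat \<Rightarrow> nat \<Rightarrow> nat set" where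
  "column pr W e i = {x. pr i x \<in> W e}"

definition uce_family :: "(nat \<Rightarrow> nat \<Rightarrow> nat) \<Rightarrow> (nat \<Rightarrow> nat set) \<Rightarrow> nat \<Rightarrow> nat set set" where
  "uce_family pr W e = {column pr W e i | i. True}"

definition content :: "(nat \<Rightarrow> nat) \<Rightarrow> nat set" where
  "content f = {x. \<exists>n. f n = x}"

definition initial_segment :: "(nat \<Rightarrow> nat) \<Rightarrow> nat \<Rightarrow> nat list" where
  "initial_segment f i = map f [0..<i]"

definition learning_machine :: "(nat list \<Rightarrow> nat option) \<Rightarrow> bool" where
  "learning_machine M \<longleftrightarrow> partial_computable (\<lambda>c. M (list_decode c))"

definition TxtBC_identifies ::
  "(nat \<Rightarrow> nat set) \<Rightarrow> (nat list \<Rightarrow> nat option) \<Rightarrow> (nat \<Rightarrow> nat) \<Rightarrow> bool" where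
  "TxtBC_identifies W M f \<longleftrightarrow>
     (\<exists>n. \<forall>i>n. \<exists>h. M (initial_segment f i) = Some h \<and> W h = content f)"

definition TxtBC_learns_set ::
  "(nat \<Rightarrow> nat set) \<Rightarrow> (nat list \<Rightarrow> nat option) \<Rightarrow> nat set \<Rightarrow> bool" where
  "TxtBC_learns_set W M A \<longleftrightarrow> (\<forall>f. content f = A \<longrightarrow> TxtBC_identifies W M f)"

definition TxtBC_learns_family ::
  "(nat \<Rightarrow> nat set) \<Rightarrow> (nat list \<Rightarrow> nat option) \<Rightarrow> nat set set \<Rightarrow> bool" where
  "TxtBC_learns_family W M F \<longleftrightarrow> (\<forall>A\<in>F. TxtBC_learns_set W M A)"

definition TxtBC_learnable :: "(nat \<Rightarrow> nat set) \<Rightarrow> nat set set \<Rightarrow> bool" where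
  "TxtBC_learnable W F \<longleftrightarrow> (\<exists>M. learning_machine M \<and> TxtBC_learns_family W M F)"

definition BCL :: "(nat \<Rightarrow> nat \<Rightarrow> nat) \<Rightarrow> (nat \<Rightarrow> nat set) \<Rightarrow> nat set" where
  "BCL pr W = {e. TxtBC_learnable W (uce_family pr W e)}"

end

theory Submission
  imports Defs
begin

text \<open>
  If a learner succeeds on every text of a nonempty set \<open>L\<close>, then every string over \<open>L\<close> extends
  to a locking one: a string over \<open>L\<close> all of whose extensions over \<open>L\<close> are mapped to a
  conjecture for \<open>L\<close>.  Conversely, if the locking strings are dense in this sense, then
  a modified learner, whose conjecture depends only on the content of the data and a bound, succeeds
  on every text of \<open>L\<close>.  Hence a family is learnable iff there is a learner for which, for
  every nonempty member \<open>L\<close> and every string over \<open>L\<close>, there is an extension \<open>\<sigma>\<close> over \<open>L\<close> such that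
  every further extension of \<open>\<sigma>\<close> over \<open>L\<close> conjectures \<open>L\<close>.  The last clause is \<open>\<Pi>\<^sup>0\<^sub>2\<close>, and the
  prefix \<open>\<exists>\<forall>\<exists>\<close> makes the whole condition \<open>\<Sigma>\<^sup>0\<^sub>5\<close>.
\<close>

section \<open>Computable functions\<close>

lemma computable_comp: "computable f \<Longrightarrow> computable g \<Longrightarrow> computable (\<lambda>x. f (g x))"
  unfolding computable_def
  using partial_computable.comp[of "\<lambda>x. Some (f x)" "\<lambda>x. Some (g x)"] by simp

lemma computable_pair:
  "computable f \<Longrightarrow> computable g \<Longrightarrow> computable (\<lambda>x. prod_encode (f x, g x))"
  unfolding computable_def
  using partial_computable.pair[of "\<lambda>x. Some (f x)" "\<lambda>x. Some (g x)"] by simp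

lemma computable_fst: "computable f \<Longrightarrow> computable (\<lambda>x. fst (prod_decode (f x)))"
  by (rule computable_comp[of "\<lambda>x. fst (prod_decode x)"])
     (simp_all add: computable_def partial_computable.left)

lemma computable_snd: "computable f \<Longrightarrow> computable (\<lambda>x. snd (prod_decode (f x)))"
  by (rule computable_comp[of "\<lambda>x. snd (prod_decode x)"])
     (simp_all add: computable_def partial_computable.right)

lemma computable_Suc: "computable f \<Longrightarrow> computable (\<lambda>x. Suc (f x))"
  by (rule computable_comp[of Suc]) (simp_all add: computable_def partial_computable.suc)

text \<open>The generators do not include the identity; it arises by pairing the two
  projections.\<close>

lemma computable_id: "computable (\<lambda>x. x)"
proof -
  have "computable (\<lambda>x. fst (prod_decode x))" "computable (\<lambda>x. snd (prod_decode x))"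
    by (simp_all add: computable_def partial_computable.left partial_computable.right)
  from computable_pair[OF this] show ?thesis by simp
qed

lemma computable_const: "computable (\<lambda>x. c)"
proof (induction c)
  case 0
  show ?case by (simp add: computable_def partial_computable.zero)
qed (rule computable_Suc)

text \<open>With total data the recursion in rule \<open>prec\<close> never reaches
  \<open>None\<close>. The step is assumed computable on codes of triples \<open>(x, k, r)\<close>,
  so it may use the input \<open>x\<close> itself.\<close>

lemma computable_rec:
  assumes "computable a" "computable n"
    and "computable (\<lambda>z. g (fst (prod_decode z)) (fst (prod_decode (snd (prod_decode z))))
           (snd (prod_decode (snd (prod_decode z)))))" (is "computable ?g")
  shows "computable (\<lambda>x. rec_nat (a x) (g x) (n x))"
proof -
  have rec: "rec_nat (Some (a x)) (\<lambda>k r. Option.bind r (\<lambda>v. Some (g x k v))) m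
      = Some (rec_nat (a x) (g x) m)" for x m
    by (induction m) auto
  have "computable (\<lambda>z. rec_nat (a (fst (prod_decode z))) (g (fst (prod_decode z))) (snd (prod_decode z)))"
    using partial_computable.prec[of "\<lambda>x. Some (a x)" "\<lambda>z. Some (?g z)"] assms(1,3)
    by (simp add: computable_def rec case_prod_beta)
  from computable_comp[OF this computable_pair[OF computable_id assms(2)]] show ?thesis by simp
qed

lemmas computable_basic =
  computable_id computable_const computable_pair computable_fst computable_snd computable_Suc

lemma computable_diff:
  assumes "computable f" "computable g"
  shows "computable (\<lambda>x. f x - g x)"
proof -
  have pred: "rec_nat 0 (\<lambda>k r. k) m = m - 1" for m :: nat
    by (cases m) auto
  have "computable (\<lambda>x. rec_nat 0 (\<lambda>k r. k) x)"
    by (intro computable_rec computable_basic)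
  then have pred_comp: "computable (\<lambda>x. h x - 1)" if "computable h" for h
    using that unfolding pred by (rule computable_comp)
  have "computable (\<lambda>x. rec_nat (f x) (\<lambda>k r. r - 1) (g x))"
    by (intro computable_rec assms computable_basic pred_comp)
  moreover have "rec_nat m (\<lambda>k r. r - 1) n = m - n" for m n :: nat
    by (induction n) auto
  ultimately show ?thesis by simp
qed

text \<open>A recursion of length \<open>c x\<close> whose step discards the accumulated value acts
  as a case distinction.\<close>

lemma computable_if_zero:
  assumes "computable c" "computable f" "computable g"
  shows "computable (\<lambda>x. if c x = 0 then f x else g x)"
proof -
  have "computable (\<lambda>x. rec_nat (f x) (\<lambda>k r. g x) (c x))"
    by (intro computable_rec assms computable_comp[OF assms(3)] computable_basic)
  moreover have "rec_nat (f x) (\<lambda>k r. g x) m = (if m = 0 then f x else g x)" for m x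
    by (cases m) auto
  ultimately show ?thesis by simp
qed

lemma computable_if:
  assumes "decidable {x. P x}" "computable f" "computable g"
  shows "computable (\<lambda>x. if P x then f x else g x)"
proof -
  have "computable (\<lambda>x. if (if P x then 1 else 0 :: nat) = 0 then g x else f x)"
    using assms by (intro computable_if_zero) (simp_all add: decidable_def)
  also have "(\<lambda>x. if (if P x then 1 else 0 :: nat) = 0 then g x else f x) = (\<lambda>x. if P x then f x else g x)"
    by auto
  finally show ?thesis .
qed

lemma decidable_comp: "decidable A \<Longrightarrow> computable f \<Longrightarrow> decidable {x. f x \<in> A}"
  unfolding decidable_def mem_Collect_eq by (rule computable_comp)

lemma decidable_eq_0: "computable f \<Longrightarrow> decidable {x. f x = 0}"
  unfolding decidable_def mem_Collect_eq by (intro computable_if_zero computable_const)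

lemma decidable_not:
  assumes "decidable {x. P x}"
  shows "decidable {x. \<not> P x}"
proof -
  have "decidable {x. (if P x then 1 else 0 :: nat) = 0}"
    using assms by (intro decidable_eq_0) (simp add: decidable_def)
  moreover have "{x. (if P x then 1 else 0 :: nat) = 0} = {x. \<not> P x}"
    by auto
  ultimately show ?thesis by simp
qed

lemma decidable_and:
  assumes "decidable {x. P x}" "decidable {x. Q x}"
  shows "decidable {x. P x \<and> Q x}"
proof -
  have "computable (\<lambda>x. if P x then if Q x then 1 else 0 else 0)"
    using assms by (intro computable_if computable_const)
  also have "(\<lambda>x. if P x then if Q x then 1 else 0 else 0) = (\<lambda>x. if P x \<and> Q x then 1 else 0 :: nat)"
    by auto
  finally show ?thesis by (simp add: decidable_def)
qed

lemma decidable_or: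
  assumes "decidable {x. P x}" "decidable {x. Q x}"
  shows "decidable {x. P x \<or> Q x}"
  using decidable_not[OF decidable_and[OF decidable_not[OF assms(1)] decidable_not[OF assms(2)]]]
  by simp

lemma decidable_imp:
  assumes "decidable {x. P x}" "decidable {x. Q x}"
  shows "decidable {x. P x \<longrightarrow> Q x}"
  using decidable_or[OF decidable_not[OF assms(1)] assms(2)] by simp

lemma decidable_eq:
  assumes "computable f" "computable g"
  shows "decidable {x. f x = g x}"
proof -
  have "decidable {x. f x - g x = 0 \<and> g x - f x = 0}"
    by (intro decidable_and decidable_eq_0 computable_diff assms)
  moreover have "{x. f x - g x = 0 \<and> g x - f x = 0} = {x. f x = g x}"
    by auto
  ultimately show ?thesis by simp
qed

text \<open>A recursion carries the truth value along; once it has dropped to 0 it stays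
  there.\<close>

lemma decidable_all_less:
  assumes "decidable {z. P (fst (prod_decode z)) (snd (prod_decode z))}" "computable n"
  shows "decidable {x. \<forall>k<n x. P x k}"
proof -
  let ?step = "\<lambda>x k r. if P x k then r else 0 :: nat"
  have *: "computable (\<lambda>z. prod_encode (fst (prod_decode z), fst (prod_decode (snd (prod_decode z)))))"
    by (intro computable_basic)
  have "computable (\<lambda>x. rec_nat 1 (?step x) (n x))"
    using decidable_comp[OF assms(1) *]
    by (intro computable_rec assms computable_basic computable_if) simp
  moreover have "rec_nat 1 (?step x) m = (if \<forall>k<m. P x k then 1 else 0)" for x m
    by (induction m) (auto simp: less_Suc_eq)
  ultimately show ?thesis by (simp add: decidable_def)
qed

section \<open>Lists as numbers\<close>

lemma snd_prod_decode_0 [simp]: "snd (prod_decode 0) = 0"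
  by (metis le_prod_encode_2 le_zero_eq prod.collapse prod_decode_inverse)

lemma list_encode_eq_0_iff [simp]: "list_encode xs = 0 \<longleftrightarrow> xs = []"
  by (cases xs) auto

text \<open>Makes the code of a list a computable bound for its positions and for loops that consume
  it.\<close>

lemma length_le_list_encode: "length xs \<le> list_encode xs"
proof (induction xs)
  case (Cons x xs)
  then show ?case using le_prod_encode_2[of "list_encode xs" x] by simp
qed simp

text \<open>For the empty list this relies on \<open>0 - 1 = 0\<close> and on \<open>0\<close> coding the pair of zeros.\<close>

lemma list_encode_tl: "list_encode (tl xs) = snd (prod_decode (list_encode xs - 1))"
  by (cases xs) auto

lemma hd_list_encode: "xs \<noteq> [] \<Longrightarrow> hd xs = fst (prod_decode (list_encode xs - 1))"
  by (cases xs) auto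

text \<open>A nonempty list has code \<open>Suc (prod_encode (x, list_encode xs))\<close>, so each
  round takes the tail; past the end the value stays 0.\<close>

definition code_drop :: "nat \<Rightarrow> nat \<Rightarrow> nat" where
  "code_drop c k = rec_nat c (\<lambda>_ r. snd (prod_decode (r - 1))) k"

definition code_nth :: "nat \<Rightarrow> nat \<Rightarrow> nat" where
  "code_nth c k = fst (prod_decode (code_drop c k - 1))"

definition code_append :: "nat \<Rightarrow> nat \<Rightarrow> nat" where
  "code_append c d = list_encode (list_decode c @ list_decode d)"

lemma code_drop_list_encode: "code_drop (list_encode xs) k = list_encode (drop k xs)"
proof (induction k)
  case (Suc k)
  then show ?case
    using list_encode_tl[of "drop k xs"] by (simp add: code_drop_def drop_Suc tl_drop)
qed (simp add: code_drop_def)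

lemma code_nth_list_encode: "k < length xs \<Longrightarrow> code_nth (list_encode xs) k = xs ! k"
  using hd_list_encode[of "drop k xs"]
  by (simp add: code_nth_def code_drop_list_encode hd_drop_conv_nth)

lemma computable_code_drop:
  "computable f \<Longrightarrow> computable g \<Longrightarrow> computable (\<lambda>x. code_drop (f x) (g x))"
  unfolding code_drop_def by (intro computable_rec computable_basic computable_diff)

lemma computable_code_nth:
  "computable f \<Longrightarrow> computable g \<Longrightarrow> computable (\<lambda>x. code_nth (f x) (g x))"
  unfolding code_nth_def by (intro computable_basic computable_diff computable_code_drop)

text \<open>Moving heads from one list onto another reverses the first, and concatenation is two
  such passes. The state \<open>r\<close> is the pair (rest, accumulator).\<close>

lemma computable_code_append:
  assumes "computable f" "computable g"
  shows "computable (\<lambda>x. code_append (f x) (g x))"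
proof -
  let ?step = "\<lambda>k r. if fst (prod_decode r) = 0 then r
    else prod_encode (snd (prod_decode (fst (prod_decode r) - 1)),
      Suc (prod_encode (fst (prod_decode (fst (prod_decode r) - 1)), snd (prod_decode r))))"
  let ?rev = "\<lambda>c d. snd (prod_decode (rec_nat (prod_encode (c, d)) ?step c))"
  have rev_comp: "computable (\<lambda>x. ?rev (a x) (b x))" if "computable a" "computable b" for a b
    using that by (intro computable_basic computable_rec computable_if_zero computable_diff)
  have "rec_nat (prod_encode (list_encode xs, list_encode ys)) ?step k
      = prod_encode (list_encode (drop k xs), list_encode (rev (take k xs) @ ys))" for xs ys k
  proof (induction k)
    case (Suc k)
    show ?case
    proof (cases "k < length xs")
      case True
      then have "drop k xs = xs ! k # drop (Suc k) xs"
        by (simp add: Cons_nth_drop_Suc)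
      then show ?thesis using Suc True by (simp add: take_Suc_conv_app_nth)
    qed (use Suc in simp)
  qed simp
  then have rev: "?rev (list_encode xs) (list_encode ys) = list_encode (rev xs @ ys)" for xs ys
    by (simp add: length_le_list_encode)
  have "code_append c d = ?rev (?rev c 0) d" for c d
    using rev[of "list_decode c" "[]"] rev[of "rev (list_decode c)" "list_decode d"]
    by (simp add: code_append_def)
  then show ?thesis
    using rev_comp[OF rev_comp[OF assms(1) computable_const] assms(2)] by simp
qed

text \<open>The code bounds the length, and \<open>code_drop c k \<noteq> 0\<close> says that
  position \<open>k\<close> exists. Quantification over a coded finite set thus becomes a bounded
  number quantifier.\<close>

lemma ball_set_list_decode:
  "(\<forall>y\<in>set (list_decode c). P y) \<longleftrightarrow> (\<forall>k<c. code_drop c k \<noteq> 0 \<longrightarrow> P (code_nth c k))"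
proof -
  define xs where "xs = list_decode c"
  have c: "c = list_encode xs" by (simp add: xs_def)
  have "(code_drop c k \<noteq> 0 \<longrightarrow> P (code_nth c k)) \<longleftrightarrow> (k < length xs \<longrightarrow> P (xs ! k))" for k
    by (auto simp: c code_drop_list_encode code_nth_list_encode)
  moreover have "length xs \<le> c"
    unfolding c by (rule length_le_list_encode)
  ultimately show ?thesis
    unfolding xs_def[symmetric] all_set_conv_all_nth by (metis order_less_le_trans)
qed

lemma decidable_mem_set:
  assumes "computable f" "computable g"
  shows "decidable {x. f x \<in> set (list_decode (g x))}"
proof -
  have *: "f x \<in> set (list_decode (g x)) \<longleftrightarrow> \<not> (\<forall>y\<in>set (list_decode (g x)). y \<noteq> f x)" for x
    by auto
  show ?thesis
    unfolding * ball_set_list_decode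
    by (intro decidable_not decidable_all_less decidable_imp decidable_eq decidable_eq_0
        computable_code_drop computable_code_nth computable_basic
        computable_comp[OF assms(1)] computable_comp[OF assms(2)] assms)
qed

lemma decidable_set_subset:
  assumes "computable f" "computable g"
  shows "decidable {x. set (list_decode (f x)) \<subseteq> set (list_decode (g x))}"
  unfolding subset_eq ball_set_list_decode
  by (intro decidable_not decidable_all_less decidable_imp decidable_eq_0 decidable_mem_set
      computable_code_drop computable_code_nth computable_basic
      computable_comp[OF assms(1)] computable_comp[OF assms(2)] assms)

section \<open>The arithmetical hierarchy\<close>

text \<open>One induction treats both classes, as each is defined from the other. \<open>f\<close>
  varies in it: one level down the substitution acts on the first component of a pair only.\<close>

lemma Sigma0_Pi0_comp:
  assumes f: "computable f"
  shows Sigma0_comp: "Sigma0 n A \<Longrightarrow> Sigma0 n {x. f x \<in> A}"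
    and Pi0_comp: "Pi0 n A \<Longrightarrow> Pi0 n {x. f x \<in> A}"
proof -
  have "\<forall>f A. computable f \<longrightarrow>
      (Sigma0 n A \<longrightarrow> Sigma0 n {x. f x \<in> A}) \<and> (Pi0 n A \<longrightarrow> Pi0 n {x. f x \<in> A})"
  proof (induction n)
    case 0
    show ?case by (simp add: decidable_comp)
  next
    case (Suc n)
    show ?case
    proof (intro allI impI conjI)
      fix f A assume f: "computable f"
      have g: "computable (\<lambda>z. prod_encode (f (fst (prod_decode z)), snd (prod_decode z)))"
        by (intro computable_basic computable_comp[OF f])
      {
        assume "Sigma0 (Suc n) A"
        then obtain B where "Pi0 n B" "A = {x. \<exists>y. prod_encode (x, y) \<in> B}" by auto
        with Suc g show "Sigma0 (Suc n) {x. f x \<in> A}"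
          unfolding Sigma0.simps by (intro exI[of _ "{z. _ z \<in> B}"]) auto
      next
        assume "Pi0 (Suc n) A"
        then obtain B where "Sigma0 n B" "A = {x. \<forall>y. prod_encode (x, y) \<in> B}" by auto
        with Suc g show "Pi0 (Suc n) {x. f x \<in> A}"
          unfolding Pi0.simps by (intro exI[of _ "{z. _ z \<in> B}"]) auto
      }
    qed
  qed
  then show "Sigma0 n A \<Longrightarrow> Sigma0 n {x. f x \<in> A}" "Pi0 n A \<Longrightarrow> Pi0 n {x. f x \<in> A}"
    using f by blast+
qed

lemma Sigma0_SucI:
  "Pi0 n {z. P (fst (prod_decode z)) (snd (prod_decode z))} \<Longrightarrow> Sigma0 (Suc n) {x. \<exists>y. P x y}"
  unfolding Sigma0.simps
  by (rule exI[of _ "{z. P (fst (prod_decode z)) (snd (prod_decode z))}"]) auto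

lemma Pi0_SucI:
  "Sigma0 n {z. P (fst (prod_decode z)) (snd (prod_decode z))} \<Longrightarrow> Pi0 (Suc n) {x. \<forall>y. P x y}"
  unfolding Pi0.simps
  by (rule exI[of _ "{z. P (fst (prod_decode z)) (snd (prod_decode z))}"]) auto

text \<open>Delivers the matrix as a relation already closed under computable substitution in both
  arguments.\<close>

lemma Sigma0_SucE:
  assumes "Sigma0 (Suc n) {x. P x}"
  obtains R where "\<And>f g. computable f \<Longrightarrow> computable g \<Longrightarrow> Pi0 n {x. R (f x) (g x)}"
    "P = (\<lambda>x. \<exists>y. R x y)"
proof -
  from assms obtain B where B: "Pi0 n B" "{x. P x} = {x. \<exists>y. prod_encode (x, y) \<in> B}"
    by auto
  show thesis
  proof (rule that[of "\<lambda>x y. prod_encode (x, y) \<in> B"])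
    show "Pi0 n {x. prod_encode (f x, g x) \<in> B}" if "computable f" "computable g" for f g
      using Pi0_comp[OF computable_pair[OF that] B(1)] .
    show "P = (\<lambda>x. \<exists>y. prod_encode (x, y) \<in> B)"
      using B(2) by (simp add: set_eq_iff fun_eq_iff)
  qed
qed

lemma Sigma0_Pi0_compl: "(Sigma0 n (- A) \<longleftrightarrow> Pi0 n A) \<and> (Pi0 n (- A) \<longleftrightarrow> Sigma0 n A)"
proof (induction n arbitrary: A)
  case 0
  have "decidable (- A) \<longleftrightarrow> decidable A" for A
    using decidable_not[of "\<lambda>x. x \<in> A"] decidable_not[of "\<lambda>x. x \<in> - A"]
    by (auto simp: Collect_neg_eq)
  then show ?case by simp
next
  case (Suc n)
  \<comment> \<open>Passing to the complement of the witness set turns one quantifier into the other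
    and lets the induction hypothesis apply.\<close>
  have ex_compl: "(\<exists>B. Q B) \<longleftrightarrow> (\<exists>B. Q (- B))" for Q :: "nat set \<Rightarrow> bool"
    by (metis double_compl)
  have ex: "- A = {x. \<exists>y. prod_encode (x, y) \<in> - B} \<longleftrightarrow> A = {x. \<forall>y. prod_encode (x, y) \<in> B}"
    and all: "- A = {x. \<forall>y. prod_encode (x, y) \<in> - B} \<longleftrightarrow> A = {x. \<exists>y. prod_encode (x, y) \<in> B}" for B
    by auto
  have "Sigma0 (Suc n) (- A) \<longleftrightarrow> (\<exists>B. Pi0 n (- B) \<and> - A = {x. \<exists>y. prod_encode (x, y) \<in> - B})"
    unfolding Sigma0.simps by (rule ex_compl)
  moreover have "Pi0 (Suc n) (- A) \<longleftrightarrow> (\<exists>B. Sigma0 n (- B) \<and> - A = {x. \<forall>y. prod_encode (x, y) \<in> - B})"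
    unfolding Pi0.simps by (rule ex_compl)
  ultimately show ?case
    unfolding ex all by (simp only: Suc Sigma0.simps Pi0.simps)
qed

lemma Sigma0_not: "Pi0 n {x. P x} \<Longrightarrow> Sigma0 n {x. \<not> P x}"
  using Sigma0_Pi0_compl by (simp add: Collect_neg_eq)

lemma Pi0_not: "Sigma0 n {x. P x} \<Longrightarrow> Pi0 n {x. \<not> P x}"
  using Sigma0_Pi0_compl by (simp add: Collect_neg_eq)

text \<open>Only the \<open>Sigma0\<close> case needs induction: two witnesses are packed into one
  number. The \<open>Pi0\<close> case follows from it at the same level by complementation, which
  also serves the matrices inside the induction.\<close>

lemma Sigma0_Pi0_and_or:
  shows Sigma0_and: "Sigma0 n {x. P x} \<Longrightarrow> Sigma0 n {x. Q x} \<Longrightarrow> Sigma0 n {x. P x \<and> Q x}"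
    and Sigma0_or: "Sigma0 n {x. P x} \<Longrightarrow> Sigma0 n {x. Q x} \<Longrightarrow> Sigma0 n {x. P x \<or> Q x}"
    and Pi0_and: "Pi0 n {x. P x} \<Longrightarrow> Pi0 n {x. Q x} \<Longrightarrow> Pi0 n {x. P x \<and> Q x}"
    and Pi0_or: "Pi0 n {x. P x} \<Longrightarrow> Pi0 n {x. Q x} \<Longrightarrow> Pi0 n {x. P x \<or> Q x}"
proof -
  have Pi_of_Sigma: "Pi0 n {x. P x \<and> Q x} \<and> Pi0 n {x. P x \<or> Q x}"
    if "\<And>P Q. Sigma0 n {x. P x} \<Longrightarrow> Sigma0 n {x. Q x} \<Longrightarrow>
          Sigma0 n {x. P x \<and> Q x} \<and> Sigma0 n {x. P x \<or> Q x}"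
      and "Pi0 n {x. P x}" "Pi0 n {x. Q x}" for n P Q
    using Pi0_not[of n "\<lambda>x. \<not> P x \<or> \<not> Q x"] Pi0_not[of n "\<lambda>x. \<not> P x \<and> \<not> Q x"]
      that(1)[OF Sigma0_not[OF that(2)] Sigma0_not[OF that(3)]] by simp
  have Sigma: "Sigma0 n {x. P x \<and> Q x} \<and> Sigma0 n {x. P x \<or> Q x}"
    if "Sigma0 n {x. P x}" "Sigma0 n {x. Q x}" for P Q
    using that
  proof (induction n arbitrary: P Q)
    case 0
    then show ?case by (simp add: decidable_and decidable_or)
  next
    case (Suc n)
    obtain R where R: "\<And>f g. computable f \<Longrightarrow> computable g \<Longrightarrow> Pi0 n {x. R (f x) (g x)}"
      "P = (\<lambda>x. \<exists>y. R x y)" using Suc.prems(1) by (rule Sigma0_SucE) blast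
    obtain S where S: "\<And>f g. computable f \<Longrightarrow> computable g \<Longrightarrow> Pi0 n {x. S (f x) (g x)}"
      "Q = (\<lambda>x. \<exists>y. S x y)" using Suc.prems(2) by (rule Sigma0_SucE) blast
    note Pi = Pi_of_Sigma[of n, OF Suc.IH]
    have "Sigma0 (Suc n) {x. \<exists>y. R x (fst (prod_decode y)) \<and> S x (snd (prod_decode y))}"
      by (intro Sigma0_SucI Pi[THEN conjunct1] R(1) S(1) computable_basic)
    moreover have "Sigma0 (Suc n) {x. \<exists>y. R x (fst (prod_decode y)) \<or> S x (snd (prod_decode y))}"
      by (intro Sigma0_SucI Pi[THEN conjunct2] R(1) S(1) computable_basic)
    moreover have "(\<exists>y. R x (fst (prod_decode y)) \<and> S x (snd (prod_decode y))) \<longleftrightarrow> P x \<and> Q x"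
      "(\<exists>y. R x (fst (prod_decode y)) \<or> S x (snd (prod_decode y))) \<longleftrightarrow> P x \<or> Q x" for x
      unfolding R(2) S(2) by (metis fst_conv snd_conv prod_encode_inverse)+
    ultimately show ?case by simp
  qed
  note Pi = Pi_of_Sigma[of n, OF Sigma]
  show "Sigma0 n {x. P x} \<Longrightarrow> Sigma0 n {x. Q x} \<Longrightarrow> Sigma0 n {x. P x \<and> Q x}"
    "Sigma0 n {x. P x} \<Longrightarrow> Sigma0 n {x. Q x} \<Longrightarrow> Sigma0 n {x. P x \<or> Q x}"
    "Pi0 n {x. P x} \<Longrightarrow> Pi0 n {x. Q x} \<Longrightarrow> Pi0 n {x. P x \<and> Q x}"
    "Pi0 n {x. P x} \<Longrightarrow> Pi0 n {x. Q x} \<Longrightarrow> Pi0 n {x. P x \<or> Q x}"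
    using Sigma Pi by blast+
qed

lemma Sigma0_imp: "Pi0 n {x. P x} \<Longrightarrow> Sigma0 n {x. Q x} \<Longrightarrow> Sigma0 n {x. P x \<longrightarrow> Q x}"
  using Sigma0_or[OF Sigma0_not] by simp

lemma Pi0_imp: "Sigma0 n {x. P x} \<Longrightarrow> Pi0 n {x. Q x} \<Longrightarrow> Pi0 n {x. P x \<longrightarrow> Q x}"
  using Pi0_or[OF Pi0_not] by simp

lemma Sigma0_Suc_of_Pi0: "Pi0 n A \<Longrightarrow> Sigma0 (Suc n) A"
  using Sigma0_SucI[of n "\<lambda>x y. x \<in> A"] Pi0_comp[of "\<lambda>z. fst (prod_decode z)" n A]
  by (simp add: computable_basic)

lemma Pi0_Suc_of_Sigma0: "Sigma0 n A \<Longrightarrow> Pi0 (Suc n) A"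
  using Pi0_SucI[of n "\<lambda>x y. x \<in> A"] Sigma0_comp[of "\<lambda>z. fst (prod_decode z)" n A]
  by (simp add: computable_basic)

lemma Sigma0_Pi0_Suc: "(Sigma0 n A \<longrightarrow> Sigma0 (Suc n) A) \<and> (Pi0 n A \<longrightarrow> Pi0 (Suc n) A)"
proof (induction n arbitrary: A)
  case 0
  show ?case using Sigma0_Suc_of_Pi0[of 0 A] Pi0_Suc_of_Sigma0[of 0 A] by simp
next
  case (Suc n)
  show ?case
  proof (intro conjI impI)
    assume "Sigma0 (Suc n) A"
    then obtain B where "Pi0 n B" "A = {x. \<exists>y. prod_encode (x, y) \<in> B}" by auto
    with Suc show "Sigma0 (Suc (Suc n)) A"
      unfolding Sigma0.simps(2)[of "Suc n"] by blast
  next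
    assume "Pi0 (Suc n) A"
    then obtain B where "Sigma0 n B" "A = {x. \<forall>y. prod_encode (x, y) \<in> B}" by auto
    with Suc show "Pi0 (Suc (Suc n)) A"
      unfolding Pi0.simps(2)[of "Suc n"] by blast
  qed
qed

lemma Sigma0_Suc: "Sigma0 n A \<Longrightarrow> Sigma0 (Suc n) A"
  using Sigma0_Pi0_Suc by blast

text \<open>Two adjacent existential quantifiers contract into one over pairs.\<close>

lemma Sigma0_ex:
  assumes "Sigma0 (Suc n) {z. P (fst (prod_decode z)) (snd (prod_decode z))}"
  shows "Sigma0 (Suc n) {x. \<exists>y. P x y}"
proof -
  obtain R where R: "\<And>f g. computable f \<Longrightarrow> computable g \<Longrightarrow> Pi0 n {x. R (f x) (g x)}"
    and P: "(\<lambda>z. P (fst (prod_decode z)) (snd (prod_decode z))) = (\<lambda>z. \<exists>u. R z u)"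
    using assms by (rule Sigma0_SucE) blast
  have P: "P x y \<longleftrightarrow> (\<exists>u. R (prod_encode (x, y)) u)" for x y
    using fun_cong[OF P, of "prod_encode (x, y)"] by simp
  have "Sigma0 (Suc n) {x. \<exists>y. R (prod_encode (x, fst (prod_decode y))) (snd (prod_decode y))}"
    by (intro Sigma0_SucI R computable_basic)
  moreover have "(\<exists>y. R (prod_encode (x, fst (prod_decode y))) (snd (prod_decode y))) \<longleftrightarrow> (\<exists>y. P x y)" for x
    unfolding P by (metis fst_conv snd_conv prod_encode_inverse)
  ultimately show ?thesis by simp
qed

lemma Pi0_all:
  assumes "Pi0 (Suc n) {z. P (fst (prod_decode z)) (snd (prod_decode z))}"
  shows "Pi0 (Suc n) {x. \<forall>y. P x y}"
  using Pi0_not[OF Sigma0_ex[of n "\<lambda>x y. \<not> P x y", OF Sigma0_not[OF assms]]] by simp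

text \<open>One witness for each \<open>k < m x\<close> is collected in a single coded list
  \<open>c\<close>, leaving a decidable bounded quantifier inside.\<close>

lemma Sigma0_1_all_less:
  assumes "Sigma0 1 {z. P (fst (prod_decode z)) (snd (prod_decode z))}" "computable m"
  shows "Sigma0 1 {x. \<forall>k<m x. P x k}"
proof -
  obtain R where R: "\<And>f g. computable f \<Longrightarrow> computable g \<Longrightarrow> decidable {x. R (f x) (g x)}"
    and P: "(\<lambda>z. P (fst (prod_decode z)) (snd (prod_decode z))) = (\<lambda>z. \<exists>u. R z u)"
    using assms(1) unfolding One_nat_def by (rule Sigma0_SucE) auto
  have P: "P x y \<longleftrightarrow> (\<exists>u. R (prod_encode (x, y)) u)" for x y
    using fun_cong[OF P, of "prod_encode (x, y)"] by simp
  have "decidable {z. \<forall>k<m (fst (prod_decode z)).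
      R (prod_encode (fst (prod_decode z), k)) (code_nth (snd (prod_decode z)) k)}"
    by (intro decidable_all_less R computable_basic computable_comp[OF assms(2)] computable_code_nth)
  then have "Sigma0 1 {x. \<exists>c. \<forall>k<m x. R (prod_encode (x, k)) (code_nth c k)}"
    unfolding One_nat_def by (intro Sigma0_SucI) simp
  moreover have "(\<exists>c. \<forall>k<m x. R (prod_encode (x, k)) (code_nth c k)) \<longleftrightarrow> (\<forall>k<m x. P x k)" for x
  proof
    assume "\<forall>k<m x. P x k"
    then obtain u where "\<forall>k<m x. R (prod_encode (x, k)) (u k)"
      unfolding P by metis
    then show "\<exists>c. \<forall>k<m x. R (prod_encode (x, k)) (code_nth c k)"
      by (intro exI[of _ "list_encode (map u [0..<m x])"]) (simp add: code_nth_list_encode)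
  qed (auto simp: P)
  ultimately show ?thesis by simp
qed

lemma Sigma0_1_decidable: "decidable A \<Longrightarrow> Sigma0 1 A"
  using Sigma0_Suc[of 0 A] by simp

text \<open>Lets c.e. atoms enter the final quantifier count on either side at every level from 2
  on.\<close>

lemma Sigma0_1_lift:
  assumes "Sigma0 1 A"
  shows "Sigma0 (Suc (Suc n)) A" "Pi0 (Suc (Suc n)) A"
proof -
  have "Sigma0 (Suc n) A" for n
  proof (induction n)
    case 0
    show ?case using assms by (simp only: One_nat_def)
  qed (rule Sigma0_Suc)
  then show "Sigma0 (Suc (Suc n)) A" "Pi0 (Suc (Suc n)) A"
    using Pi0_Suc_of_Sigma0 by blast+
qed

lemma Sigma0_1_imp:
  assumes "decidable {x. P x}" "Sigma0 1 {x. Q x}"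
  shows "Sigma0 1 {x. P x \<longrightarrow> Q x}"
  using Sigma0_or[OF Sigma0_1_decidable[OF decidable_not[OF assms(1)]] assms(2)]
  by simp

lemma Sigma0_1_ex:
  "Sigma0 1 {z. P (fst (prod_decode z)) (snd (prod_decode z))} \<Longrightarrow> Sigma0 1 {x. \<exists>y. P x y}"
  using Sigma0_ex[of 0] by simp

section \<open>Computably enumerable sets\<close>

text \<open>The list \<open>c\<close> is a computation history: entry \<open>k\<close> is the value
  after \<open>k\<close> rounds.\<close>

lemma rec_nat_bind_eq_Some_iff:
  "rec_nat a (\<lambda>k r. Option.bind r (g k)) n = Some v \<longleftrightarrow>
    (\<exists>c. a = Some (code_nth c 0) \<and> (\<forall>k<n. g k (code_nth c k) = Some (code_nth c (Suc k))) \<and> code_nth c n = v)"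
  (is "?r n = _ \<longleftrightarrow> ?R")
proof
  assume r: "?r n = Some v"
  \<comment> \<open>A defined value at \<open>n\<close> forces all earlier values to be
    defined.\<close>
  have def: "\<exists>w. ?r k = Some w" if "k \<le> n" for k
    using that by (induction k rule: inc_induct) (use r in \<open>auto simp: bind_eq_Some_conv\<close>)
  define c where "c = list_encode (map (\<lambda>k. the (?r k)) [0..<Suc n])"
  have nth: "code_nth c k = the (?r k)" if "k \<le> n" for k
    unfolding c_def using that by (subst code_nth_list_encode) (simp_all del: upt_Suc)
  have "g k (the (?r k)) = Some (the (?r (Suc k)))" if "k < n" for k
    using def[of k] def[of "Suc k"] that by auto
  then have "\<forall>k<n. g k (code_nth c k) = Some (code_nth c (Suc k))"
    by (simp add: nth)
  moreover have "a = Some (code_nth c 0)" "code_nth c n = v"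
    using def[of 0] r by (auto simp: nth)
  ultimately show ?R by blast
next
  assume ?R
  then obtain c where c: "a = Some (code_nth c 0)" "\<forall>k<n. g k (code_nth c k) = Some (code_nth c (Suc k))"
    "code_nth c n = v" by blast
  have "?r k = Some (code_nth c k)" if "k \<le> n" for k
    using that by (induction k) (use c in auto)
  then show "?r n = Some v" using c by auto
qed

text \<open>Induction on the generation of \<open>f\<close>. The terms \<open>a\<close> and
  \<open>b\<close> stay arbitrary so that the hypotheses apply to quantified intermediate
  values.\<close>

lemma Sigma0_1_graph:
  assumes "partial_computable f"
  shows "computable a \<Longrightarrow> computable b \<Longrightarrow> Sigma0 1 {x. f (a x) = Some (b x)}"
  using assms
proof (induction f arbitrary: a b rule: partial_computable.induct)
  case zero
  then show ?case
    by (simp only: option.inject) (intro Sigma0_1_decidable decidable_eq computable_const)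
next
  case suc
  then show ?case
    by (simp only: option.inject) (intro Sigma0_1_decidable decidable_eq computable_Suc)
next
  case left
  then show ?case
    by (simp only: option.inject) (intro Sigma0_1_decidable decidable_eq computable_fst)
next
  case right
  then show ?case
    by (simp only: option.inject) (intro Sigma0_1_decidable decidable_eq computable_snd)
next
  case (pair f g)
  have "Sigma0 1 {x. f (a x) = Some (fst (prod_decode (b x))) \<and> g (a x) = Some (snd (prod_decode (b x)))}"
    by (intro Sigma0_and pair computable_basic)
  moreover have "Option.bind (f y) (\<lambda>v. Option.bind (g y) (\<lambda>w. Some (prod_encode (v, w)))) = Some z \<longleftrightarrow>
      f y = Some (fst (prod_decode z)) \<and> g y = Some (snd (prod_decode z))" for y z
    by (auto simp: bind_eq_Some_conv)
  ultimately show ?case by simp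
next
  case (comp f g)
  have "Sigma0 1 {x. \<exists>v. g (a x) = Some v \<and> f v = Some (b x)}"
    by (intro Sigma0_1_ex Sigma0_and comp.IH computable_basic
        computable_comp[OF comp.prems(1)] computable_comp[OF comp.prems(2)])
  then show ?case by (simp add: bind_eq_Some_conv)
next
  case (prec f g)
  let ?p = "\<lambda>x. fst (prod_decode (a x))" and ?n = "\<lambda>x. snd (prod_decode (a x))"
  have "Sigma0 1 {x. \<exists>c. f (?p x) = Some (code_nth c 0) \<and>
      (\<forall>k<?n x. g (prod_encode (?p x, prod_encode (k, code_nth c k))) = Some (code_nth c (Suc k))) \<and>
      code_nth c (?n x) = b x}"
    by (intro Sigma0_1_ex Sigma0_and Sigma0_1_all_less Sigma0_1_decidable decidable_eq prec.IH
        computable_basic computable_code_nth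
        computable_comp[OF prec.prems(1)] computable_comp[OF prec.prems(2)])
  then show ?case by (simp add: case_prod_beta rec_nat_bind_eq_Some_iff)
next
  case (minim f)
  have "Sigma0 1 {x. f (prod_encode (a x, b x)) = Some 0 \<and>
      (\<forall>k<b x. \<exists>w. f (prod_encode (a x, k)) = Some (Suc w))}"
    by (intro Sigma0_and Sigma0_1_all_less Sigma0_1_ex minim.IH minim.prems computable_basic
        computable_comp[OF minim.prems(1)])
  \<comment> \<open>The definition asks for defined values below some zero \<open>n\<close>. The
    least zero is at most \<open>n\<close>, so all values below it are defined and nonzero.\<close>
  moreover have "(if \<exists>n. f (prod_encode (y, n)) = Some 0 \<and> (\<forall>k<n. f (prod_encode (y, k)) \<noteq> None)
      then Some (LEAST n. f (prod_encode (y, n)) = Some 0) else None) = Some z \<longleftrightarrow>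
      f (prod_encode (y, z)) = Some 0 \<and> (\<forall>k<z. \<exists>w. f (prod_encode (y, k)) = Some (Suc w))" (is "?L \<longleftrightarrow> ?R")
    for y z
  proof
    assume ?L
    then obtain n where n: "f (prod_encode (y, n)) = Some 0" "\<forall>k<n. f (prod_encode (y, k)) \<noteq> None"
      and z: "z = (LEAST n. f (prod_encode (y, n)) = Some 0)"
      by (auto split: if_splits)
    have "z \<le> n" unfolding z using n(1) by (rule Least_le)
    moreover have "f (prod_encode (y, z)) = Some 0" unfolding z using n(1) by (rule LeastI)
    moreover have "f (prod_encode (y, k)) \<noteq> Some 0" if "k < z" for k
      using that not_less_Least unfolding z by blast
    ultimately show ?R using n(2) by (metis not0_implies_Suc option.exhaust order_less_le_trans)
  next
    assume R: ?R
    then have "(LEAST n. f (prod_encode (y, n)) = Some 0) = z"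
      by (intro Least_equality) (auto intro: leI)
    with R show ?L by fastforce
  qed
  ultimately show ?case by simp
qed

lemma ce_iff_Sigma0_1: "ce A \<longleftrightarrow> Sigma0 1 A"
proof
  assume "ce A"
  then obtain f where f: "partial_computable f" "A = dom f"
    by (auto simp: ce_def)
  have "Sigma0 1 {x. \<exists>v. f x = Some v}"
    by (intro Sigma0_1_ex Sigma0_1_graph f computable_basic)
  then show "Sigma0 1 A" by (simp add: f dom_def)
next
  assume "Sigma0 1 A"
  then obtain B where B: "decidable B" "A = {x. \<exists>y. prod_encode (x, y) \<in> B}"
    by auto
  \<comment> \<open>Minimisation searches for the value 0, so 0 has to mark membership in
    \<open>B\<close>.\<close>
  let ?f = "\<lambda>z. Some (if z \<notin> B then 1 else 0 :: nat)"
  have "partial_computable ?f"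
    using decidable_not[of "\<lambda>z. z \<in> B"] B(1) by (simp add: decidable_def computable_def)
  note f = partial_computable.minim[OF this]
  show "ce A"
    unfolding ce_def by (rule exI, rule conjI, rule f) (auto simp: dom_def B(2))
qed

section \<open>Numberings and learners\<close>

lemma standard_numbering_Sigma0_1:
  assumes "standard_numbering W" "computable a" "computable b"
  shows "Sigma0 1 {x. a x \<in> W (b x)}"
proof -
  have "Sigma0 1 {prod_encode (e, x) | e x. x \<in> W e}"
    using assms(1) by (simp add: standard_numbering_def ce_iff_Sigma0_1)
  from Sigma0_comp[OF computable_pair[OF assms(3,2)] this] show ?thesis by simp
qed

text \<open>\<open>A\<close> is every section of the cylinder over it; the index \<open>g 0\<close>
  is an arbitrary choice.\<close>

lemma standard_numbering_surj:
  assumes "standard_numbering W" "ce A"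
  obtains e where "W e = A"
proof -
  have "Sigma0 1 {z. snd (prod_decode z) \<in> A}"
    using assms(2) by (intro Sigma0_comp computable_basic) (simp add: ce_iff_Sigma0_1)
  then obtain g where "\<forall>e. W (g e) = {x. prod_encode (e, x) \<in> {z. snd (prod_decode z) \<in> A}}"
    using assms(1) unfolding standard_numbering_def ce_iff_Sigma0_1 by blast
  then show thesis using that[of "g 0"] by simp
qed

text \<open>By the s-m-n theorem a learner is the same thing as a c.e. set of pairs (string, number)
  whose section at a string is the set conjectured there.\<close>

definition conjecture :: "nat set \<Rightarrow> nat list \<Rightarrow> nat set" where
  "conjecture V \<sigma> = {x. prod_encode (list_encode \<sigma>, x) \<in> V}"

definition BC_learns :: "(nat list \<Rightarrow> nat set) \<Rightarrow> nat set \<Rightarrow> bool" where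
  "BC_learns C L \<longleftrightarrow> (\<forall>f. content f = L \<longrightarrow> (\<exists>n. \<forall>i>n. C (initial_segment f i) = L))"

text \<open>Where the machine is undefined, the section of the c.e. set is simply empty. Conversely,
  the s-m-n function is a total machine.\<close>

lemma TxtBC_learnable_iff_conjecture:
  assumes W: "standard_numbering W"
  shows "TxtBC_learnable W F \<longleftrightarrow> (\<exists>v. \<forall>L\<in>F. BC_learns (conjecture (W v)) L)"
proof
  assume "TxtBC_learnable W F"
  then obtain M where M: "partial_computable (\<lambda>c. M (list_decode c))" "TxtBC_learns_family W M F"
    by (auto simp: TxtBC_learnable_def learning_machine_def)
  have "Sigma0 1 {z. \<exists>h. M (list_decode (fst (prod_decode z))) = Some h \<and> snd (prod_decode z) \<in> W h}"
    (is "Sigma0 1 ?V")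
    by (intro Sigma0_1_ex Sigma0_and Sigma0_1_graph[OF M(1)] standard_numbering_Sigma0_1[OF W] computable_basic)
  then have "ce ?V" by (simp only: ce_iff_Sigma0_1)
  from standard_numbering_surj[OF W this] obtain v where v: "W v = ?V" by blast
  have conj: "conjecture (W v) \<sigma> = W h" if "M \<sigma> = Some h" for \<sigma> h
    using that by (simp add: v conjecture_def)
  have "BC_learns (conjecture (W v)) L" if "L \<in> F" for L
    unfolding BC_learns_def
  proof (intro allI impI)
    fix f assume f: "content f = L"
    then have "TxtBC_identifies W M f"
      using M(2) that by (simp add: TxtBC_learns_family_def TxtBC_learns_set_def)
    then obtain n where n: "\<forall>i>n. \<exists>h. M (initial_segment f i) = Some h \<and> W h = content f"
      unfolding TxtBC_identifies_def ..
    show "\<exists>n. \<forall>i>n. conjecture (W v) (initial_segment f i) = L"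
    proof (intro exI[of _ n] allI impI)
      fix i assume "n < i"
      with n obtain h where "M (initial_segment f i) = Some h" "W h = content f" by blast
      then show "conjecture (W v) (initial_segment f i) = L" using conj f by simp
    qed
  qed
  then show "\<exists>v. \<forall>L\<in>F. BC_learns (conjecture (W v)) L" by blast
next
  assume "\<exists>v. \<forall>L\<in>F. BC_learns (conjecture (W v)) L"
  then obtain v where v: "\<forall>L\<in>F. BC_learns (conjecture (W v)) L" ..
  have "Sigma0 1 {x. x \<in> W v}"
    by (intro standard_numbering_Sigma0_1[OF W] computable_basic)
  then obtain g where g: "computable g" "\<forall>e. W (g e) = {x. prod_encode (e, x) \<in> W v}"
    using W unfolding standard_numbering_def ce_iff_Sigma0_1 Collect_mem_eq by blast
  let ?M = "\<lambda>\<sigma>. Some (g (list_encode \<sigma>))"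
  have "learning_machine ?M"
    using g(1) by (simp add: learning_machine_def computable_def)
  moreover have "TxtBC_learns_family W ?M F"
    using v g(2) by (simp add: TxtBC_learns_family_def TxtBC_learns_set_def TxtBC_identifies_def
        BC_learns_def conjecture_def)
  ultimately show "TxtBC_learnable W F"
    unfolding TxtBC_learnable_def by blast
qed

section \<open>Locking strings\<close>

definition densely_locking :: "(nat list \<Rightarrow> nat set) \<Rightarrow> nat set \<Rightarrow> bool" where
  "densely_locking C L \<longleftrightarrow> (\<forall>\<sigma>. set \<sigma> \<subseteq> L \<longrightarrow>
     (\<exists>\<tau>. set \<tau> \<subseteq> L \<and> (\<forall>\<rho>. set \<rho> \<subseteq> L \<longrightarrow> C (\<sigma> @ \<tau> @ \<rho>) = L)))"

text \<open>If no extension of \<open>\<sigma>\<close> over \<open>L\<close> locks, a text for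
  \<open>L\<close> grows from \<open>\<sigma>\<close> by alternately appending an element of
  \<open>L\<close> and a string \<open>R\<close> that spoils the conjecture. The learner then errs
  infinitely often on it.\<close>

lemma densely_locking_if_BC_learns:
  assumes learns: "BC_learns C L" and "L \<noteq> {}"
  shows "densely_locking C L"
proof (rule ccontr)
  assume "\<not> densely_locking C L"
  then obtain \<sigma> where \<sigma>: "set \<sigma> \<subseteq> L"
    and "\<forall>\<tau>. set \<tau> \<subseteq> L \<longrightarrow> (\<exists>\<rho>. set \<rho> \<subseteq> L \<and> C (\<sigma> @ \<tau> @ \<rho>) \<noteq> L)"
    by (auto simp: densely_locking_def)
  then obtain R where R: "\<And>\<tau>. set \<tau> \<subseteq> L \<Longrightarrow> set (R \<tau>) \<subseteq> L \<and> C (\<sigma> @ \<tau> @ R \<tau>) \<noteq> L"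
    by metis
  obtain b where "b \<in> L" using \<open>L \<noteq> {}\<close> by blast
  \<comment> \<open>An enumeration of \<open>L\<close> with \<open>b\<close> as default value; here
    nonemptiness enters.\<close>
  define a where "a k = (if k \<in> L then k else b)" for k
  have a: "range a = L" using \<open>b \<in> L\<close> by (force simp: a_def)
  define t where "t = rec_nat [] (\<lambda>k \<tau>. (\<tau> @ [a k]) @ R (\<tau> @ [a k]))"
  have t_Suc: "t (Suc k) = (t k @ [a k]) @ R (t k @ [a k])" for k
    by (simp add: t_def)
  have t_subset: "set (t k) \<subseteq> L" for k
  proof (induction k)
    case (Suc k)
    then have "set (t k @ [a k]) \<subseteq> L" using a by auto
    with R[OF this] show ?case by (simp add: t_Suc)
  qed (simp add: t_def)
  have wrong: "C (\<sigma> @ t (Suc k)) \<noteq> L" for k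
    using R[of "t k @ [a k]"] t_subset[of k] a by (auto simp: t_Suc)
  define u where "u k = \<sigma> @ t k" for k
  have u_Suc: "\<exists>zs. u (Suc k) = u k @ a k # zs" for k
    by (simp add: u_def t_Suc)
  have u_mono: "\<exists>zs. u m = u k @ zs" if "k \<le> m" for k m
    using that
  proof (induction m rule: dec_induct)
    case (step m)
    then show ?case using u_Suc[of m] by auto
  qed simp
  have u_len: "k \<le> length (u k)" for k
  proof (induction k)
    case (Suc k)
    then show ?case using u_Suc[of k] by auto
  qed simp
  \<comment> \<open>The text is the limit of the chain \<open>u\<close>. Position \<open>n\<close>
    is settled at stage \<open>Suc n\<close>, whose string has length at least
    \<open>Suc n\<close>.\<close>
  define f where "f n = u (Suc n) ! n" for n
  have f_nth: "f n = u k ! n" if "n < length (u k)" for n k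
  proof (cases "k \<le> Suc n")
    case True
    then show ?thesis using u_mono[OF True] that by (auto simp: f_def nth_append)
  next
    case False
    then have "Suc n \<le> k" by simp
    then show ?thesis using u_mono[of "Suc n" k] u_len[of "Suc n"] by (auto simp: f_def nth_append)
  qed
  have f_init: "initial_segment f (length (u k)) = u k" for k
    by (rule nth_equalityI) (simp_all add: initial_segment_def f_nth)
  have u_subset: "set (u k) \<subseteq> L" for k
    using \<sigma> t_subset by (simp add: u_def)
  have "f n \<in> L" for n
    using u_len[of "Suc n"] u_subset[of "Suc n"] unfolding f_def by (meson Suc_le_lessD nth_mem subsetD)
  moreover have "a k \<in> range f" for k
  proof -
    obtain zs where zs: "u (Suc k) = u k @ a k # zs" using u_Suc by blast
    then have "f (length (u k)) = a k" using f_nth[of "length (u k)" "Suc k"] by simp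
    then show ?thesis by (metis rangeI)
  qed
  ultimately have "range f = L"
    using a by blast
  then have "content f = L"
    by (auto simp: content_def)
  then obtain n where n: "\<forall>i>n. C (initial_segment f i) = L"
    using learns by (auto simp: BC_learns_def)
  have "length (u (Suc n)) > n" using u_len[of "Suc n"] by simp
  with n have "C (u (Suc n)) = L" using f_init by metis
  then show False using wrong by (simp add: u_def)
qed

text \<open>The conjecture below depends only on the content \<open>D\<close> of the data and on a bound \<open>c\<close>.  Let
  \<open>s\<^sub>0\<close> be a locking string for \<open>L\<close>, and let \<open>D\<close> and \<open>c\<close> be large.  An element accepted through
  \<open>s \<le> s\<^sub>0\<close> passes the test at a locking extension of \<open>s\<close>, and one accepted through
  \<open>s > s\<^sub>0\<close> passes a test at an extension of \<open>s\<^sub>0\<close>; so it lies in \<open>L\<close>.  Conversely \<open>s\<^sub>0\<close> accepts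
  all of \<open>L\<close>, because every \<open>s' < s\<^sub>0\<close> has a locking extension.\<close>

definition stabilized :: "(nat list \<Rightarrow> nat set) \<Rightarrow> nat set \<Rightarrow> nat \<Rightarrow> nat set" where
  "stabilized C D c = {x. \<exists>s. set (list_decode s) \<subseteq> D \<and>
     (\<forall>t<c. set (list_decode t) \<subseteq> D \<longrightarrow> x \<in> C (list_decode s @ list_decode t)) \<and>
     (\<forall>s'<s. set (list_decode s') \<subseteq> D \<longrightarrow>
        (\<exists>t. set (list_decode t) \<subseteq> D \<and> x \<in> C (list_decode s' @ list_decode t)))}"

text \<open>Makes "large" precise by a finite set and a number, both depending on \<open>L\<close>
  alone once \<open>C\<close> is fixed, not on a text.\<close>

lemma stabilized_eq:
  assumes "densely_locking C L"
  obtains D n where "finite D" "D \<subseteq> L"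
    "\<And>E c. D \<subseteq> E \<Longrightarrow> E \<subseteq> L \<Longrightarrow> n \<le> c \<Longrightarrow> stabilized C E c = L"
proof -
  obtain T where T: "\<And>\<sigma>. set \<sigma> \<subseteq> L \<Longrightarrow> set (T \<sigma>) \<subseteq> L"
    and lock: "\<And>\<sigma> \<rho>. set \<sigma> \<subseteq> L \<Longrightarrow> set \<rho> \<subseteq> L \<Longrightarrow> C (\<sigma> @ T \<sigma> @ \<rho>) = L"
    using assms unfolding densely_locking_def by metis
  define s0 where "s0 = list_encode (T [])"
  have s0: "set (list_decode s0) \<subseteq> L" using T[of "[]"] by (simp add: s0_def)
  have lock0: "C (list_decode s0 @ \<rho>) = L" if "set \<rho> \<subseteq> L" for \<rho>
    using lock[of "[]" \<rho>] that by (simp add: s0_def)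
  define S where "S = {s. s \<le> s0 \<and> set (list_decode s) \<subseteq> L}"
  define code where "code s = list_encode (T (list_decode s))" for s
  have "finite S" by (simp add: S_def)
  \<comment> \<open>\<open>D\<close> and \<open>n\<close> are chosen so that every
    \<open>s \<le> s0\<close> over \<open>L\<close> finds its own locking extension: the elements
    lie in \<open>D\<close>, the code is below \<open>n\<close>.\<close>
  define D where "D = set (list_decode s0) \<union> (\<Union>s\<in>S. set (T (list_decode s)))"
  define n where "n = Suc (\<Sum>s\<in>S. code s)"
  have code_less: "code s < n" if "s \<in> S" for s
    using member_le_sum[OF that, of code] \<open>finite S\<close> by (simp add: n_def)
  show thesis
  proof (rule that)
    show "finite D" using \<open>finite S\<close> by (simp add: D_def)
    show "D \<subseteq> L" using s0 T by (auto simp: D_def S_def)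
    fix E c assume E: "D \<subseteq> E" "E \<subseteq> L" and c: "n \<le> c"
    have T_E: "set (list_decode (code s)) \<subseteq> E" if "s \<in> S" for s
      using that E(1) by (auto simp: D_def code_def)
    have lock_code: "C (list_decode s @ list_decode (code s)) = L" if "s \<in> S" for s
      using that lock[of "list_decode s" "[]"] by (simp add: code_def S_def)
    have s0_E: "set (list_decode s0) \<subseteq> E" using E(1) by (auto simp: D_def)
    show "stabilized C E c = L"
    proof
      show "stabilized C E c \<subseteq> L"
      proof
        fix x assume "x \<in> stabilized C E c"
        then obtain s where s: "set (list_decode s) \<subseteq> E"
          and all: "\<forall>t<c. set (list_decode t) \<subseteq> E \<longrightarrow> x \<in> C (list_decode s @ list_decode t)"
          and less: "\<forall>s'<s. set (list_decode s') \<subseteq> E \<longrightarrow>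
            (\<exists>t. set (list_decode t) \<subseteq> E \<and> x \<in> C (list_decode s' @ list_decode t))"
          unfolding stabilized_def by blast
        show "x \<in> L"
        proof (cases "s \<le> s0")
          case True
          then have "s \<in> S" using s E(2) by (auto simp: S_def)
          then show ?thesis using all T_E code_less c lock_code by (metis order_less_le_trans)
        next
          case False
          then show ?thesis using less s0_E lock0 E(2) by (metis linorder_not_le subset_trans)
        qed
      qed
      show "L \<subseteq> stabilized C E c"
      proof
        fix x assume x: "x \<in> L"
        have "\<exists>t. set (list_decode t) \<subseteq> E \<and> x \<in> C (list_decode s @ list_decode t)"
          if "s < s0" "set (list_decode s) \<subseteq> E" for s
        proof -
          have "s \<in> S" using that E(2) by (auto simp: S_def)
          then show ?thesis using T_E lock_code x by blast
        qed
        moreover have "x \<in> C (list_decode s0 @ list_decode t)" if "set (list_decode t) \<subseteq> E" for t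
          using that lock0 E(2) x by blast
        ultimately show "x \<in> stabilized C E c"
          unfolding stabilized_def using s0_E by blast
      qed
    qed
  qed
qed

text \<open>Every text for \<open>L\<close> eventually shows all of the finite set \<open>D\<close>,
  and the code of an initial segment is at least its length, so it passes \<open>n\<close>
  too.\<close>

lemma BC_learns_stabilized:
  assumes "densely_locking C L"
  shows "BC_learns (\<lambda>\<sigma>. stabilized C (set \<sigma>) (list_encode \<sigma>)) L"
  unfolding BC_learns_def
proof (intro allI impI)
  fix f assume f: "content f = L"
  obtain D n where D: "finite D" "D \<subseteq> L"
    and eq: "\<And>E c. D \<subseteq> E \<Longrightarrow> E \<subseteq> L \<Longrightarrow> n \<le> c \<Longrightarrow> stabilized C E c = L"
    using assms by (rule stabilized_eq) blast
  obtain m where m: "D \<subseteq> f ` {..<m}"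
  proof -
    have "D \<subseteq> range f" using D f by (auto simp: content_def)
    then obtain B where B: "finite B" "D = f ` B" using D(1) by (metis finite_subset_image)
    then obtain m where "B \<subseteq> {..<m}" unfolding finite_nat_set_iff_bounded by (meson lessThan_iff subsetI)
    then show thesis using that B(2) by blast
  qed
  show "\<exists>n. \<forall>i>n. stabilized C (set (initial_segment f i)) (list_encode (initial_segment f i)) = L"
  proof (intro exI[of _ "max m n"] allI impI eq)
    fix i assume i: "max m n < i"
    have "set (initial_segment f i) = f ` {..<i}"
      by (auto simp: initial_segment_def)
    then show "D \<subseteq> set (initial_segment f i)" using m i by fastforce
    show "set (initial_segment f i) \<subseteq> L"
      using f by (auto simp: initial_segment_def content_def)
    show "n \<le> list_encode (initial_segment f i)"
      using length_le_list_encode[of "initial_segment f i"] i by (simp add: initial_segment_def)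
  qed
qed

text \<open>The empty set has no text, so every learner learns it vacuously. From right to left the
  learner changes from \<open>v\<close> to its stabilized version \<open>w\<close>.\<close>

lemma TxtBC_learnable_iff_densely_locking:
  assumes W: "standard_numbering W"
  shows "TxtBC_learnable W F \<longleftrightarrow>
    (\<exists>v. \<forall>L\<in>F. L \<noteq> {} \<longrightarrow> densely_locking (conjecture (W v)) L)"
proof
  assume "TxtBC_learnable W F"
  then show "\<exists>v. \<forall>L\<in>F. L \<noteq> {} \<longrightarrow> densely_locking (conjecture (W v)) L"
    unfolding TxtBC_learnable_iff_conjecture[OF W] using densely_locking_if_BC_learns by blast
next
  assume "\<exists>v. \<forall>L\<in>F. L \<noteq> {} \<longrightarrow> densely_locking (conjecture (W v)) L"
  then obtain v where v: "\<And>L. L \<in> F \<Longrightarrow> L \<noteq> {} \<Longrightarrow> densely_locking (conjecture (W v)) L"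
    by blast
  let ?V = "{z. snd (prod_decode z) \<in>
    stabilized (conjecture (W v)) (set (list_decode (fst (prod_decode z)))) (fst (prod_decode z))}"
  \<comment> \<open>All universal quantifiers in \<open>stabilized\<close> over numbers are bounded
    by \<open>c\<close> or \<open>s\<close>, and inclusion between contents of coded lists is
    decidable.\<close>
  have "Sigma0 1 ?V"
    unfolding stabilized_def conjecture_def mem_Collect_eq code_append_def[symmetric]
    by (intro Sigma0_1_ex Sigma0_and Sigma0_1_all_less Sigma0_1_imp Sigma0_1_decidable[OF decidable_set_subset]
        decidable_set_subset standard_numbering_Sigma0_1[OF W] computable_basic computable_code_append)
  then have "ce ?V" by (simp only: ce_iff_Sigma0_1)
  from standard_numbering_surj[OF W this] obtain w where w: "W w = ?V" by blast
  have conj: "conjecture (W w) = (\<lambda>\<sigma>. stabilized (conjecture (W v)) (set \<sigma>) (list_encode \<sigma>))"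
    by (rule ext, subst conjecture_def) (simp add: w)
  have "BC_learns (conjecture (W w)) L" if "L \<in> F" for L
  proof (cases "L = {}")
    case True
    then show ?thesis by (auto simp: BC_learns_def content_def)
  next
    case False
    then show ?thesis unfolding conj using v that by (intro BC_learns_stabilized) auto
  qed
  then show "TxtBC_learnable W F"
    unfolding TxtBC_learnable_iff_conjecture[OF W] by blast
qed

section \<open>Quantifier count for the set of learnable codes\<close>

theorem theorem4p2:
  fixes pr :: "nat \<Rightarrow> nat \<Rightarrow> nat" and W :: "nat \<Rightarrow> nat set"
  assumes "computable_pairing pr"
    and "standard_numbering W"
  shows "Sigma0 5 (BCL pr W)"
proof -
  note W = assms(2)
  have pr: "computable (\<lambda>x. pr (a x) (b x))" if "computable a" "computable b" for a b
    using computable_comp[of "\<lambda>z. pr (fst (prod_decode z)) (snd (prod_decode z))"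
        "\<lambda>x. prod_encode (a x, b x)"] computable_pair[OF that] assms(1)
    by (simp add: computable_pairing_def computable2_def)
  have mem: "Sigma0 1 {x. a x \<in> column pr W (b x) (c x)}"
    if "computable a" "computable b" "computable c" for a b c
    unfolding column_def mem_Collect_eq
    by (intro standard_numbering_Sigma0_1[OF W] pr that)
  \<comment> \<open>Inclusion of a coded finite set in a column is a bounded quantifier over c.e.
    conditions.\<close>
  have sub: "Sigma0 1 {x. set (list_decode (a x)) \<subseteq> column pr W (b x) (c x)}"
    if "computable a" "computable b" "computable c" for a b c
    unfolding subset_eq ball_set_list_decode
    by (intro Sigma0_1_all_less Sigma0_1_imp decidable_not decidable_eq_0 mem computable_basic
        computable_code_drop computable_code_nth that computable_comp[OF that(1)]
        computable_comp[OF that(2)] computable_comp[OF that(3)])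
  have mem_W: "Sigma0 1 {x. a x \<in> W (b x)}" if "computable a" "computable b" for a b
    using W that by (rule standard_numbering_Sigma0_1)
  have lists: "(\<forall>\<sigma>. P \<sigma>) \<longleftrightarrow> (\<forall>s. P (list_decode s))"
    "(\<exists>\<sigma>. P \<sigma>) \<longleftrightarrow> (\<exists>s. P (list_decode s))" for P :: "nat list \<Rightarrow> bool"
    by (metis list_encode_inverse)+
  have "BCL pr W = {e. \<exists>v. \<forall>i. (\<exists>a. a \<in> column pr W e i) \<longrightarrow>
      (\<forall>s. set (list_decode s) \<subseteq> column pr W e i \<longrightarrow>
        (\<exists>t. set (list_decode t) \<subseteq> column pr W e i \<and>
          (\<forall>r. set (list_decode r) \<subseteq> column pr W e i \<longrightarrow>
            (\<forall>x. (prod_encode (code_append s (code_append t r), x) \<in> W v \<longrightarrow> x \<in> column pr W e i) \<and>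
               (x \<in> column pr W e i \<longrightarrow> prod_encode (code_append s (code_append t r), x) \<in> W v)))))}"
  proof -
    \<comment> \<open>Set equality is split into two implications between c.e. conditions, each of
      them \<open>\<Pi>\<^sup>0\<^sub>2\<close>.\<close>
    have eq: "{x. prod_encode (c, x) \<in> W v} = L \<longleftrightarrow>
        (\<forall>x. (prod_encode (c, x) \<in> W v \<longrightarrow> x \<in> L) \<and> (x \<in> L \<longrightarrow> prod_encode (c, x) \<in> W v))" for c v L
      by blast
    have columns: "(\<forall>L\<in>uce_family pr W e. P L) \<longleftrightarrow> (\<forall>i. P (column pr W e i))" for e P
      by (auto simp: uce_family_def)
    show ?thesis
      unfolding BCL_def TxtBC_learnable_iff_densely_locking[OF W] columns densely_locking_def lists
      by (simp only: conjecture_def code_append_def list_encode_inverse eq ex_in_conv)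
  qed
  \<comment> \<open>From the inside out: the matrix with \<open>r\<close> and \<open>x\<close> is
    \<open>\<Pi>\<^sup>0\<^sub>2\<close>, \<open>t\<close> makes it
    \<open>\<Sigma>\<^sup>0\<^sub>3\<close>, \<open>s\<close> and \<open>i\<close> together
    \<open>\<Pi>\<^sup>0\<^sub>4\<close>, and \<open>v\<close> gives
    \<open>\<Sigma>\<^sup>0\<^sub>5\<close>. The premises are all c.e. and do not raise the
    level.\<close>
  also have "Sigma0 (Suc (Suc (Suc (Suc (Suc 0))))) \<dots>"
    by (intro Sigma0_SucI[of "Suc (Suc (Suc (Suc 0)))"] Pi0_all Pi0_imp
        Pi0_SucI[of "Suc (Suc (Suc 0))"] Sigma0_imp Sigma0_ex Sigma0_and
        Sigma0_Suc_of_Pi0[of "Suc (Suc 0)"] Pi0_and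
        Sigma0_1_lift mem sub mem_W computable_basic computable_code_append)
  finally show ?thesis by (simp add: eval_nat_numeral)
qed

end
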